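(* Let $C$ be a linear code over a finite commutative chain ring $R$, and let $\chi:R\to\mathbb{C}$ be a generating character of $R$. Then $$\mathrm{swe}_{C^\perp}(\mathbf{x})=\frac{1}{|C|}\,\mathrm{swe}_C(\mathbf{S}\mathbf{x}),$$ where $\mathbf{S}=(s_{ij})$ is the $(\nu+1)\times(\nu+1)$ matrix with rows and columns indexed by $\{0,1,\dots,\nu\}$ and, for any $i,j\in\{0,1,\dots,\nu\}$, $$s_{ij}:=\sum_{r\in\gamma^{\nu-j}R^\times}\chi(r\gamma^{\nu-i})=\begin{cases}1&\text{if } j=0;\\ q^{j}-q^{j-1}&\text{if } 1\le j\le \nu-i;\\ -q^{\nu-i}&\text{if } j=\nu+1-i;\\ 0&\text{otherwise.}\end{cases}$$
   Context: Rings have an identity. A finite commutative chain ring is a finite commutative ring $R$ whose ideals form a chain under inclusion. Let $\gamma$ be a generator of its maximal ideal, $\nu$ the smallest positive integer with $\gamma^\nu=0$, and $q=|R/\gamma R|$. Its ideals are $\gamma^\nu R\subsetneq\cdots\subsetneq\gamma R\subsetneq R$. $R^\times$ is the group of units and $aR^\times=\{ab: b\in R^\times\}$. The representatives of the classes of the relation "$r\approx s$ iff $rR=sR$" are chosen as $a_i=\gamma^{\nu-i}$, $0\le i\le\nu$ (with $\gamma^0=1$). A linear code $C$ of length $n$ over $R$ is an $R$-submodule of $R^n$; $C^\perp=\{\mathbf v\in R^n: \sum_{\ell=1}^n u_\ell v_\ell=0\text{ for all }\mathbf u\in C\}$. For $\mathbf c\in R^n$ let $S_i(\mathbf c)=\{\ell\in\{1,\dots,n\}: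 c_\ell R=\gamma^{\nu-i}R\}$. With $\mathbf x=(x_0,\dots,x_\nu)^T$ a column vector of indeterminates, $\mathrm{swe}_C(\mathbf x)=\sum_{\mathbf c\in C}\prod_{i=0}^\nu x_i^{|S_i(\mathbf c)|}$, and $\mathrm{swe}_C(\mathbf S\mathbf x)$ means substituting the $i$-th entry of $\mathbf S\mathbf x$ for $x_i$. A generating character of $R$ is a character $\chi$ of the additive group of $R$ (a homomorphism $(R,+)\to\mathbb C^\times$) such that every character of $(R,+)$ is of the form $s\mapsto\chi(rs)$ for some $r\in R$. *)

theory Defs
  imports "HOL-Analysis.Analysis" "HOL-Library.Poly_Mapping"
begin

section \<open>Finite commutative chain rings\<close>

text \<open>
  The ring is the whole of a type of class \<open>{finite, comm_ring_1}\<close>; in particular \<open>0 \<noteq> 1\<close>.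
  Ideals are the submodules of the ring regarded as a module over itself.
\<close>

lemma module_ring_self: "module ((*) :: 'a::comm_ring_1 \<Rightarrow> 'a \<Rightarrow> 'a)"
  by unfold_locales (simp_all add: algebra_simps)

definition ring_ideal :: "'a::comm_ring_1 set \<Rightarrow> bool" where
  "ring_ideal I \<longleftrightarrow> module.subspace (*) I"

lemma ring_ideal_iff:
  "ring_ideal I \<longleftrightarrow> 0 \<in> I \<and> (\<forall>x\<in>I. \<forall>y\<in>I. x + y \<in> I) \<and> (\<forall>r. \<forall>x\<in>I. r * x \<in> I)"
  unfolding ring_ideal_def by (rule module.subspace_def[OF module_ring_self])

definition chain_ring :: "'a::comm_ring_1 itself \<Rightarrow> bool" where
  "chain_ring TYPE('a) \<longleftrightarrow>
     (\<forall>I J :: 'a set. ring_ideal I \<longrightarrow> ring_ideal J \<longrightarrow> I \<subseteq> J \<or> J \<subseteq> I)"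

definition maximal_ideal :: "'a::comm_ring_1 set \<Rightarrow> bool" where
  "maximal_ideal M \<longleftrightarrow>
     ring_ideal M \<and> M \<noteq> UNIV \<and> (\<forall>I. ring_ideal I \<longrightarrow> M \<subseteq> I \<longrightarrow> I = M \<or> I = UNIV)"

definition principal_ideal :: "'a::comm_ring_1 \<Rightarrow> 'a set" where
  "principal_ideal a = (\<lambda>r. a * r) ` UNIV"

definition quotient_ring :: "'a::comm_ring_1 set \<Rightarrow> 'a set set" where
  "quotient_ring I = UNIV // {(a, b). a - b \<in> I}"

definition associates :: "'a::comm_ring_1 \<Rightarrow> 'a set" where
  "associates a = (\<lambda>u. a * u) ` {u. u dvd 1}"


section \<open>Generating characters\<close>

definition additive_character :: "('a::comm_ring_1 \<Rightarrow> complex) \<Rightarrow> bool" where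
  "additive_character \<psi> \<longleftrightarrow> (\<forall>a. \<psi> a \<noteq> 0) \<and> (\<forall>a b. \<psi> (a + b) = \<psi> a * \<psi> b)"

definition generating_character :: "('a::comm_ring_1 \<Rightarrow> complex) \<Rightarrow> bool" where
  "generating_character \<psi> \<longleftrightarrow>
     additive_character \<psi> \<and> (\<forall>\<phi>. additive_character \<phi> \<longrightarrow> (\<exists>r. \<phi> = (\<lambda>s. \<psi> (r * s))))"


section \<open>Linear codes\<close>

lemma module_vec: "module ((*s) :: 'a::comm_ring_1 \<Rightarrow> 'a ^ 'n \<Rightarrow> 'a ^ 'n)"
  by unfold_locales (simp_all add: vec_eq_iff algebra_simps)

definition linear_code :: "('a::comm_ring_1 ^ 'n) set \<Rightarrow> bool" where
  "linear_code C \<longleftrightarrow> module.subspace (*s) C"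

lemma linear_code_iff:
  "linear_code C \<longleftrightarrow> 0 \<in> C \<and> (\<forall>u\<in>C. \<forall>v\<in>C. u + v \<in> C) \<and> (\<forall>r. \<forall>v\<in>C. r *s v \<in> C)"
  unfolding linear_code_def by (rule module.subspace_def[OF module_vec])

definition dual_code :: "('a::comm_ring_1 ^ 'n) set \<Rightarrow> ('a ^ 'n) set" where
  "dual_code C = {v. \<forall>u\<in>C. (\<Sum>l\<in>UNIV. u $ l * v $ l) = 0}"


section \<open>Polynomials over the complex numbers\<close>

text \<open>
  A monomial is a finitely supported exponent function \<open>nat \<Rightarrow>\<^sub>0 nat\<close>, and the convolution
  product on \<open>(nat \<Rightarrow>\<^sub>0 nat) \<Rightarrow>\<^sub>0 complex\<close> is multiplication of polynomials in the
  indeterminates \<open>indet 0, indet 1, \<dots>\<close>.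
\<close>

type_synonym cpoly = "(nat \<Rightarrow>\<^sub>0 nat) \<Rightarrow>\<^sub>0 complex"

definition const_poly :: "complex \<Rightarrow> cpoly" where
  "const_poly a = Poly_Mapping.single 0 a"

definition indet :: "nat \<Rightarrow> cpoly" where
  "indet i = Poly_Mapping.single (Poly_Mapping.single i 1) 1"

definition substitute :: "(nat \<Rightarrow> cpoly) \<Rightarrow> cpoly \<Rightarrow> cpoly" where
  "substitute \<sigma> p =
     (\<Sum>m\<in>Poly_Mapping.keys p. const_poly (Poly_Mapping.lookup p m) *
        (\<Prod>i\<in>Poly_Mapping.keys m. \<sigma> i ^ Poly_Mapping.lookup m i))"


section \<open>Symmetrized weight enumerators\<close>

definition class_support :: "'a::comm_ring_1 \<Rightarrow> nat \<Rightarrow> nat \<Rightarrow> 'a ^ 'n \<Rightarrow> 'n set" where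
  "class_support \<gamma> \<nu> i c = {l. principal_ideal (c $ l) = principal_ideal (\<gamma> ^ (\<nu> - i))}"

definition swe :: "'a::comm_ring_1 \<Rightarrow> nat \<Rightarrow> ('a ^ 'n) set \<Rightarrow> cpoly" where
  "swe \<gamma> \<nu> C = (\<Sum>c\<in>C. \<Prod>i\<le>\<nu>. indet i ^ card (class_support \<gamma> \<nu> i c))"

text \<open>Only the entries with \<open>i, j \<le> \<nu>\<close> belong to the matrix.\<close>

definition character_matrix ::
  "('a::comm_ring_1 \<Rightarrow> complex) \<Rightarrow> 'a \<Rightarrow> nat \<Rightarrow> nat \<Rightarrow> nat \<Rightarrow> complex" where
  "character_matrix \<psi> \<gamma> \<nu> i j = (\<Sum>r\<in>associates (\<gamma> ^ (\<nu> - j)). \<psi> (r * \<gamma> ^ (\<nu> - i)))"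

end

theory Submission
  imports Defs
begin

text \<open>
  Over a finite commutative ring characters separate points, because a character of an additive
  subgroup extends one element at a time; hence a generating character is nontrivial on every
  nonzero ideal. So the sum of \<open>r \<mapsto> \<psi> (r * a)\<close> over an ideal \<open>I\<close> is \<open>card I\<close> or \<open>0\<close>, according
  to whether \<open>a * I\<close> vanishes. Each class of associates is a difference of two consecutive
  ideals of the chain, which gives the matrix entries. The enumerator identity is Poisson
  summation on the code, the entries of \<open>S\<close> being the Fourier transform of the
  function \<open>r \<mapsto> x\<^sub>i\<close>, with \<open>i\<close> the class of \<open>r\<close>.
\<close>

section \<open>Characters\<close>

lemma additive_character_0: "additive_character \<psi> \<Longrightarrow> \<psi> 0 = 1"
  unfolding additive_character_def by (metis add.right_neutral mult_cancel_left1)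

text \<open>The equation \<open>z ^ m = w\<close> has exactly \<open>m\<close> complex solutions, so
  a root exists, and for \<open>w = 1\<close> and \<open>1 < m\<close> one of them differs from 1.
  Roots serve as values of an extended character at a newly adjoined element.\<close>

lemma exists_nth_root:
  fixes w :: complex
  assumes "w \<noteq> 0" "0 < m"
  obtains z where "z ^ m = w" "w = 1 \<Longrightarrow> 1 < m \<Longrightarrow> z \<noteq> 1"
proof (cases "w = 1 \<and> 1 < m")
  case True
  have "card {z::complex. z ^ m = 1} = m"
    using assms by (simp add: card_roots_unity_eq)
  then have "\<not> {z::complex. z ^ m = 1} \<subseteq> {1}"
    using True card_mono[of "{1::complex}" "{z. z ^ m = 1}"] by auto
  then obtain z :: complex where "z ^ m = 1" "z \<noteq> 1" by blast
  then show ?thesis using that True by blast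
next
  case False
  have "card {z::complex. z ^ m = w} = m"
    using assms by (simp add: card_nth_roots)
  then have "{z::complex. z ^ m = w} \<noteq> {}" using assms by (metis card.empty less_irrefl)
  then show ?thesis using that False by blast
qed

section \<open>Extending characters from additive subgroups\<close>

definition add_subgroup :: "'a::comm_ring_1 set \<Rightarrow> bool" where
  "add_subgroup H \<longleftrightarrow> 0 \<in> H \<and> (\<forall>x\<in>H. \<forall>y\<in>H. x - y \<in> H)"

lemma add_subgroup_closed:
  assumes "add_subgroup H"
  shows add_subgroup_zero: "0 \<in> H"
    and add_subgroup_diff: "x \<in> H \<Longrightarrow> y \<in> H \<Longrightarrow> x - y \<in> H"
    and add_subgroup_add: "x \<in> H \<Longrightarrow> y \<in> H \<Longrightarrow> x + y \<in> H"
    and add_subgroup_of_nat_mult: "x \<in> H \<Longrightarrow> of_nat k * x \<in> H"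
proof -
  show zero: "0 \<in> H" and diff: "\<And>x y. x \<in> H \<Longrightarrow> y \<in> H \<Longrightarrow> x - y \<in> H"
    using assms by (auto simp: add_subgroup_def)
  show add: "x + y \<in> H" if "x \<in> H" "y \<in> H" for x y
    using diff[OF that(1) diff[OF zero that(2)]] by simp
  show "of_nat k * x \<in> H" if "x \<in> H"
    by (induction k) (auto simp: zero algebra_simps intro: add that)
qed

text \<open>The domain is an additive subgroup and not an ideal, because adjoining the multiples of
  one element yields no more than that. Values of \<open>\<phi>\<close> outside \<open>H\<close> are
  arbitrary.\<close>

definition partial_character :: "'a::comm_ring_1 set \<Rightarrow> ('a \<Rightarrow> complex) \<Rightarrow> bool" where
  "partial_character H \<phi> \<longleftrightarrow> add_subgroup H \<and> (\<forall>x\<in>H. \<phi> x \<noteq> 0) \<and>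
     (\<forall>x\<in>H. \<forall>y\<in>H. \<phi> (x + y) = \<phi> x * \<phi> y)"

lemma partial_character_0: "partial_character H \<phi> \<Longrightarrow> \<phi> 0 = 1"
  unfolding partial_character_def add_subgroup_def
  by (metis add.right_neutral mult_cancel_left1)

lemma partial_character_of_nat_mult:
  assumes "partial_character H \<phi>" "x \<in> H"
  shows "\<phi> (of_nat k * x) = \<phi> x ^ k"
proof (induction k)
  case 0
  then show ?case using partial_character_0[OF assms(1)] by simp
next
  case (Suc k)
  have "of_nat k * x \<in> H"
    using assms add_subgroup_of_nat_mult by (auto simp: partial_character_def)
  then show ?case using assms Suc
    by (simp add: partial_character_def algebra_simps)
qed

text \<open>The number \<open>m\<close> is the order of \<open>x\<close> modulo \<open>H\<close>;
  division with remainder shows that it divides every admissible \<open>k\<close>.\<close>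

lemma exists_minimal_multiple:
  fixes x :: "'a::{finite, comm_ring_1}"
  assumes H: "add_subgroup H"
  obtains m where "0 < m" "\<And>k. of_nat k * x \<in> H \<longleftrightarrow> m dvd k"
proof -
  define P where "P k \<longleftrightarrow> 0 < k \<and> of_nat k * x \<in> H" for k :: nat
  \<comment> \<open>The characteristic of a finite ring is positive and annihilates
    \<open>x\<close>, so some positive multiple of \<open>x\<close> lies in
    \<open>H\<close>.\<close>
  have ex: "P (CHAR('a))"
    using finite_imp_CHAR_pos[OF finite[of "UNIV :: 'a set"]] add_subgroup_zero[OF H] by (simp add: P_def)
  define m where "m = (LEAST k. P k)"
  have m: "0 < m" "of_nat m * x \<in> H" using LeastI[of P, OF ex] by (auto simp: m_def P_def)
  have "m dvd k" if k: "of_nat k * x \<in> H" for k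
  proof -
    have "of_nat k = (of_nat (k div m) * of_nat m + of_nat (k mod m) :: 'a)"
      by (metis div_mult_mod_eq of_nat_add of_nat_mult)
    then have "of_nat (k mod m) * x = of_nat k * x - of_nat (k div m) * (of_nat m * x)"
      by (simp add: algebra_simps)
    also have "\<dots> \<in> H"
      using add_subgroup_diff[OF H k add_subgroup_of_nat_mult[OF H m(2)]] .
    finally have "\<not> 0 < k mod m"
      using not_less_Least[of "k mod m" P, folded m_def] m(1) unfolding P_def by simp
    then show ?thesis by auto
  qed
  moreover have "of_nat k * x \<in> H" if "m dvd k" for k
  proof -
    from that obtain t where "k = m * t" by blast
    then have "of_nat k * x = of_nat t * (of_nat m * x)" by (simp add: algebra_simps)
    then show ?thesis using add_subgroup_of_nat_mult[OF H m(2)] by simp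
  qed
  ultimately show ?thesis using that m(1) by blast
qed

text \<open>The extension sends \<open>h + of_nat k * x\<close> to
  \<open>\<phi> h * \<zeta> ^ k\<close>. Two representations of the same element have exponents that
  differ by a multiple of \<open>m\<close>, and the condition on \<open>\<zeta> ^ m\<close> makes
  their values agree. The root \<open>\<zeta>\<close> remains a free choice, which is what allows
  points to be separated.\<close>

lemma partial_character_extend_step:
  fixes x :: "'a::{finite, comm_ring_1}"
  assumes \<phi>: "partial_character H \<phi>"
    and m: "0 < m" "\<And>k. of_nat k * x \<in> H \<longleftrightarrow> m dvd k"
    and \<zeta>: "\<zeta> ^ m = \<phi> (of_nat m * x)"
  obtains H' \<phi>' where "partial_character H' \<phi>'" "H \<subseteq> H'" "x \<in> H'"
    "\<And>h. h \<in> H \<Longrightarrow> \<phi>' h = \<phi> h" "\<phi>' x = \<zeta>"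
proof -
  have H: "add_subgroup H" using \<phi> by (simp add: partial_character_def)
  have mxH: "of_nat m * x \<in> H" using m(2)[of m] by simp
  have "\<phi> (of_nat m * x) \<noteq> 0" using \<phi> mxH unfolding partial_character_def by blast
  then have \<zeta>0: "\<zeta> \<noteq> 0" using \<zeta> m(1) by (metis zero_power)
  \<comment> \<open>The order \<open>k \<le> k'\<close> keeps the natural subtraction
    \<open>k' - k\<close> exact; \<open>wd\<close> recovers the general case by symmetry.\<close>
  have wd_le: "\<phi> h * \<zeta> ^ k = \<phi> h' * \<zeta> ^ k'"
    if "h \<in> H" "h' \<in> H" "h + of_nat k * x = h' + of_nat k' * x" "k \<le> k'" for h h' k k'
  proof -
    have eq: "of_nat (k' - k) * x = h - h'" using that by (simp add: of_nat_diff algebra_simps)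
    also have "\<dots> \<in> H" using that H add_subgroup_diff by blast
    finally obtain t where t: "k' - k = m * t" unfolding m(2) by blast
    have "h - h' = of_nat t * (of_nat m * x)" using t eq by (simp add: algebra_simps)
    then have "\<phi> (h - h') = \<zeta> ^ (k' - k)"
      using partial_character_of_nat_mult[OF \<phi> mxH, of t] \<zeta> t by (simp only: power_mult)
    moreover have "\<phi> h = \<phi> h' * \<phi> (h - h')"
      using \<phi> that add_subgroup_diff[OF H]
      unfolding partial_character_def by (metis add_diff_cancel_left' add_diff_eq)
    moreover have "\<zeta> ^ k' = \<zeta> ^ (k' - k) * \<zeta> ^ k"
      using that by (simp flip: power_add)
    ultimately show ?thesis by simp
  qed
  have wd: "\<phi> h * \<zeta> ^ k = \<phi> h' * \<zeta> ^ k'"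
    if "h \<in> H" "h' \<in> H" "h + of_nat k * x = h' + of_nat k' * x" for h h' k k'
    using wd_le[of h h' k k'] wd_le[of h' h k' k] that by (cases "k \<le> k'") auto
  \<comment> \<open>Natural multiples suffice: since \<open>of_nat m * x\<close> lies in
    \<open>H\<close> with \<open>m\<close> positive, negative multiples of \<open>x\<close> are
    covered modulo \<open>H\<close>.\<close>
  define H' where "H' = {h + of_nat k * x | h k. h \<in> H}"
  define \<phi>' where "\<phi>' y = (SOME z. \<exists>h\<in>H. \<exists>k. y = h + of_nat k * x \<and> z = \<phi> h * \<zeta> ^ k)" for y
  have \<phi>': "\<phi>' (h + of_nat k * x) = \<phi> h * \<zeta> ^ k" if "h \<in> H" for h k
    unfolding \<phi>'_def
  proof (rule some_equality)
    show "\<exists>h'\<in>H. \<exists>k'. h + of_nat k * x = h' + of_nat k' * x \<and> \<phi> h * \<zeta> ^ k = \<phi> h' * \<zeta> ^ k'"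
      using that by blast
    show "z = \<phi> h * \<zeta> ^ k"
      if "\<exists>h'\<in>H. \<exists>k'. h + of_nat k * x = h' + of_nat k' * x \<and> z = \<phi> h' * \<zeta> ^ k'" for z
      using that wd[OF \<open>h \<in> H\<close>] by metis
  qed
  have H'I: "h + of_nat k * x \<in> H'" if "h \<in> H" for h k using that by (auto simp: H'_def)
  have sub: "add_subgroup H'"
    unfolding add_subgroup_def
  proof (intro conjI ballI)
    show "0 \<in> H'" using H'I[OF add_subgroup_zero[OF H], of 0] by simp
  next
    fix y z assume "y \<in> H'" "z \<in> H'"
    then obtain h k h' k' where *: "y = h + of_nat k * x" "z = h' + of_nat k' * x" "h \<in> H" "h' \<in> H"
      by (auto simp: H'_def)
    \<comment> \<open>To avoid a negative multiple, \<open>- k' * x\<close> is rewritten as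
      \<open>(m * k' - k') * x\<close> minus \<open>k' * (m * x)\<close>, whose last term belongs to
      \<open>H\<close>.\<close>
    have "k' \<le> m * k'" using m(1) by simp
    then have dk: "of_nat (m * k' - k') = (of_nat m * of_nat k' - of_nat k' :: 'a)"
      by (simp add: of_nat_diff)
    have "y - z = (h - h' - of_nat k' * (of_nat m * x)) + of_nat (k + (m * k' - k')) * x"
      unfolding *(1,2) of_nat_add dk by (simp add: algebra_simps)
    moreover have "h - h' - of_nat k' * (of_nat m * x) \<in> H"
      using * add_subgroup_diff[OF H add_subgroup_diff[OF H] add_subgroup_of_nat_mult[OF H mxH]]
      by blast
    ultimately show "y - z \<in> H'" using H'I by metis
  qed
  have "partial_character H' \<phi>'"
    unfolding partial_character_def
  proof (intro conjI ballI sub)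
    fix y assume "y \<in> H'"
    then show "\<phi>' y \<noteq> 0" using \<phi> \<zeta>0 \<phi>' by (auto simp: H'_def partial_character_def)
  next
    fix y z assume "y \<in> H'" "z \<in> H'"
    then obtain h k h' k' where *: "y = h + of_nat k * x" "z = h' + of_nat k' * x" "h \<in> H" "h' \<in> H"
      by (auto simp: H'_def)
    then have "y + z = (h + h') + of_nat (k + k') * x" by (simp add: algebra_simps)
    then have "\<phi>' (y + z) = \<phi> (h + h') * \<zeta> ^ (k + k')"
      using \<phi>' add_subgroup_add[OF H] * by metis
    then show "\<phi>' (y + z) = \<phi>' y * \<phi>' z"
      using * \<phi> \<phi>' by (simp add: partial_character_def power_add)
  qed
  moreover have "H \<subseteq> H'" using H'I[of _ 0] by auto
  moreover have "x \<in> H'" using H'I[OF add_subgroup_zero[OF H], of 1] by simp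
  moreover have "\<phi>' h = \<phi> h" if "h \<in> H" for h using \<phi>'[OF that, of 0] by simp
  moreover have "\<phi>' x = \<zeta>"
    using \<phi>'[OF add_subgroup_zero[OF H], of 1] partial_character_0[OF \<phi>] by simp
  ultimately show ?thesis using that by blast
qed

text \<open>Induction on the size of the complement of \<open>H\<close>: as long as an element
  \<open>x\<close> is missing, adjoin it, with any \<open>m\<close>-th root of
  \<open>\<phi> (of_nat m * x)\<close> as its value.\<close>

lemma partial_character_extend:
  fixes \<phi> :: "'a::{finite, comm_ring_1} \<Rightarrow> complex"
  assumes "partial_character H \<phi>"
  obtains \<psi> where "additive_character \<psi>" "\<And>h. h \<in> H \<Longrightarrow> \<psi> h = \<phi> h"
proof -
  have "\<exists>\<psi>. additive_character \<psi> \<and> (\<forall>h\<in>H. \<psi> h = \<phi> h)" using assms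
  proof (induction "card (- H)" arbitrary: H \<phi> rule: less_induct)
    case less
    show ?case
    proof (cases "H = UNIV")
      case True
      then show ?thesis using less.prems
        by (auto simp: partial_character_def additive_character_def)
    next
      case False
      then obtain x where x: "x \<notin> H" by blast
      have H: "add_subgroup H" using less.prems by (simp add: partial_character_def)
      obtain m where m: "0 < m" "\<And>k. of_nat k * x \<in> H \<longleftrightarrow> m dvd k"
        using exists_minimal_multiple[OF H] by metis
      have "of_nat m * x \<in> H" using m(2)[of m] by simp
      then have "\<phi> (of_nat m * x) \<noteq> 0" using less.prems by (simp add: partial_character_def)
      then obtain \<zeta> where "\<zeta> ^ m = \<phi> (of_nat m * x)" using exists_nth_root m(1) by metis
      from partial_character_extend_step[OF less.prems m this] obtain H' \<phi>'
        where *: "partial_character H' \<phi>'" "H \<subseteq> H'" "x \<in> H'" "\<And>h. h \<in> H \<Longrightarrow> \<phi>' h = \<phi> h" by blast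
      have "- H' \<subset> - H" using x * by blast
      then have "card (- H') < card (- H)" by (intro psubset_card_mono) auto
      with less.hyps[OF this *(1)] * show ?thesis by (metis subsetD)
    qed
  qed
  then show ?thesis using that by blast
qed

text \<open>Start from the trivial character on \<open>{0}\<close>. The order \<open>m\<close> of
  \<open>a\<close> exceeds 1, so \<open>a\<close> can be given an \<open>m\<close>-th root of unity
  other than 1 as its value, and the result extends to the whole ring.\<close>

lemma exists_separating_character:
  fixes a :: "'a::{finite, comm_ring_1}"
  assumes "a \<noteq> 0"
  obtains \<phi> where "additive_character \<phi>" "\<phi> a \<noteq> 1"
proof -
  have triv: "partial_character {0::'a} (\<lambda>_. 1)"
    by (simp add: partial_character_def add_subgroup_def)
  then have "add_subgroup {0::'a}" by (simp add: partial_character_def)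
  then obtain m where m: "0 < m" "\<And>k. of_nat k * a \<in> {0} \<longleftrightarrow> m dvd k"
    using exists_minimal_multiple by metis
  have "m \<noteq> 1" using m(2)[of 1] assms by auto
  then have "1 < m" using m(1) by simp
  then obtain \<zeta> :: complex where \<zeta>: "\<zeta> ^ m = 1" "\<zeta> \<noteq> 1"
    using exists_nth_root[of 1 m] m(1) by auto
  obtain H \<phi> where "partial_character H \<phi>" "a \<in> H" "\<phi> a = \<zeta>"
    using partial_character_extend_step[OF triv m \<zeta>(1)] by metis
  then show ?thesis using partial_character_extend that \<zeta>(2) by metis
qed

section \<open>Generating characters and orthogonality\<close>

lemma generating_character_nontrivial:
  fixes a :: "'a::{finite, comm_ring_1}"
  assumes "generating_character \<psi>" "a \<noteq> 0"
  obtains r where "\<psi> (r * a) \<noteq> 1"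
proof -
  obtain \<phi> where \<phi>: "additive_character \<phi>" "\<phi> a \<noteq> 1"
    using exists_separating_character[OF assms(2)] .
  then obtain r where "\<phi> = (\<lambda>s. \<psi> (r * s))" using assms(1) by (auto simp: generating_character_def)
  then show ?thesis using \<phi>(2) that by blast
qed

text \<open>Translation by \<open>s\<close> permutes \<open>S\<close> and multiplies the sum by
  \<open>\<psi> (f s)\<close>, which is not 1. The additive map \<open>f\<close> covers both uses:
  multiplication by a ring element on an ideal, and the inner product with a fixed vector on a
  code.\<close>

lemma sum_additive_character_eq_0:
  fixes f :: "'b::ab_group_add \<Rightarrow> 'a::comm_ring_1"
  assumes "additive_character \<psi>" "finite S"
    and closed: "\<And>x y. x \<in> S \<Longrightarrow> y \<in> S \<Longrightarrow> x + y \<in> S"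
    and add: "\<And>x y. f (x + y) = f x + f y"
    and s: "s \<in> S" "\<psi> (f s) \<noteq> 1"
  shows "(\<Sum>x\<in>S. \<psi> (f x)) = 0"
proof -
  have "inj_on (\<lambda>x. x + s) S" by (simp add: inj_on_def)
  then have "bij_betw (\<lambda>x. x + s) S S"
    using assms(2) closed s(1) by (metis bij_betw_def endo_inj_surj image_subsetI)
  then have "(\<Sum>x\<in>S. \<psi> (f x)) = (\<Sum>x\<in>S. \<psi> (f (x + s)))"
    by (rule sum.reindex_bij_betw[symmetric])
  also have "\<dots> = (\<Sum>x\<in>S. \<psi> (f x)) * \<psi> (f s)"
    using assms(1) by (simp add: add additive_character_def sum_distrib_right)
  finally show ?thesis using s(2) by simp
qed

section \<open>Finite chain rings\<close>

lemma principal_ideal_dvd: "principal_ideal a = {x. a dvd x}"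
  by (auto simp: principal_ideal_def dvd_def)

lemma principal_ideal_eq_iff: "principal_ideal a = principal_ideal b \<longleftrightarrow> a dvd b \<and> b dvd a"
  unfolding principal_ideal_dvd set_eq_iff mem_Collect_eq by (meson dvd_refl dvd_trans)

lemma ring_ideal_principal_ideal: "ring_ideal (principal_ideal a)"
  by (auto simp: ring_ideal_iff principal_ideal_dvd)

lemma card_quotient_kernel:
  fixes f :: "'a::finite \<Rightarrow> 'b"
  shows "card (UNIV // {(a, b). f a = f b}) = card (range f)"
proof -
  have "{(a, b). f a = f b} `` {a} = {b. f b = f a}" for a by auto
  then have "UNIV // {(a, b). f a = f b} = (\<lambda>y. {b. f b = y}) ` range f"
    by (auto simp: quotient_def)
  moreover have "inj_on (\<lambda>y. {b. f b = y}) (range f)"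
    by (rule inj_onI) blast
  ultimately show ?thesis by (simp add: card_image)
qed

text \<open>The first isomorphism theorem in counting form: each nonempty fibre of \<open>f\<close>
  on \<open>G\<close> is a translate of the kernel. The domain is a set \<open>G\<close>, so that
  the lemma applies to ideals.\<close>

lemma card_eq_card_image_times_card_kernel:
  fixes f :: "'a::ab_group_add \<Rightarrow> 'b::ab_group_add"
  assumes "finite G"
    and diff: "\<And>x y. x \<in> G \<Longrightarrow> y \<in> G \<Longrightarrow> x - y \<in> G"
    and add: "\<And>x y. x \<in> G \<Longrightarrow> y \<in> G \<Longrightarrow> x + y \<in> G"
    and hom: "\<And>x y. f (x + y) = f x + f y"
  shows "card G = card (f ` G) * card {x \<in> G. f x = 0}"
proof -
  have fd: "f (x - y) = f x - f y" for x y
    using hom[of "x - y" y] by (simp add: algebra_simps)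
  have "card {x \<in> G. f x = y} = card {x \<in> G. f x = 0}" if "y \<in> f ` G" for y
  proof -
    from that obtain g where g: "g \<in> G" "f g = y" by blast
    have "bij_betw (\<lambda>x. x + g) {x \<in> G. f x = 0} {x \<in> G. f x = y}"
      by (rule bij_betw_byWitness[where f' = "\<lambda>x. x - g"]) (use g in \<open>auto simp: fd hom diff add\<close>)
    then show ?thesis by (simp add: bij_betw_same_card)
  qed
  moreover have "card G = (\<Sum>y\<in>f ` G. card {x \<in> G. f x = y})"
    using sum.image_gen[OF assms(1), of "\<lambda>_. 1::nat" f] by simp
  ultimately show ?thesis by simp
qed

locale finite_chain_ring =
  fixes \<gamma> :: "'a::{finite, comm_ring_1}" and \<nu> :: nat
  assumes chain: "chain_ring TYPE('a)"
    and maximal: "maximal_ideal (principal_ideal \<gamma>)"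
    and nilpotent: "\<gamma> ^ \<nu> = 0"
    and minimal: "\<And>k. k > 0 \<Longrightarrow> \<gamma> ^ k = 0 \<Longrightarrow> \<nu> \<le> k"
begin

section \<open>Divisibility by powers of the generator\<close>

lemma not_unit: "\<not> \<gamma> dvd 1"
proof
  assume "\<gamma> dvd 1"
  then have "\<gamma> dvd x" for x by (rule dvd_trans) simp
  then have "principal_ideal \<gamma> = UNIV" by (simp add: principal_ideal_dvd)
  then show False using maximal by (simp add: maximal_ideal_def)
qed

text \<open>The ideals of \<open>x\<close> and \<open>\<gamma>\<close> are comparable. If the ideal
  of \<open>x\<close> is the larger one, maximality leaves only the ideal of \<open>\<gamma>\<close>
  itself or the whole ring.\<close>

lemma unit_or_dvd: "x dvd 1 \<or> \<gamma> dvd x"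
proof -
  consider "principal_ideal x \<subseteq> principal_ideal \<gamma>" | "principal_ideal \<gamma> \<subseteq> principal_ideal x"
    using chain ring_ideal_principal_ideal unfolding chain_ring_def by blast
  then show ?thesis
  proof cases
    case 1
    then have "\<gamma> dvd x" unfolding principal_ideal_dvd by (meson dvd_refl mem_Collect_eq subsetD)
    then show ?thesis ..
  next
    case 2
    then have "principal_ideal x = principal_ideal \<gamma> \<or> principal_ideal x = UNIV"
      using maximal ring_ideal_principal_ideal by (auto simp: maximal_ideal_def)
    then have "x \<in> principal_ideal \<gamma> \<or> 1 \<in> principal_ideal x"
      by (metis UNIV_I dvd_refl mem_Collect_eq principal_ideal_dvd)
    then show ?thesis unfolding principal_ideal_dvd by auto
  qed
qed

lemma generator_power_eq_0_iff: "\<gamma> ^ k = 0 \<longleftrightarrow> \<nu> \<le> k"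
proof
  \<comment> \<open>The hypothesis \<open>minimal\<close> speaks of positive exponents;
    \<open>k = 0\<close> is excluded by \<open>1 \<noteq> 0\<close>.\<close>
  show "\<nu> \<le> k" if "\<gamma> ^ k = 0" using that minimal by (cases "k = 0") auto
  show "\<gamma> ^ k = 0" if "\<nu> \<le> k" using le_imp_power_dvd[OF that, of \<gamma>] nilpotent by simp
qed

lemma unit_diff: "1 - \<gamma> * r dvd 1"
proof (rule ccontr)
  assume "\<not> ?thesis"
  then have "\<gamma> dvd (1 - \<gamma> * r) + \<gamma> * r" using unit_or_dvd by (intro dvd_add) auto
  then show False using not_unit by simp
qed

text \<open>If a higher power divides \<open>\<gamma> ^ j\<close>, then \<open>\<gamma> ^ j\<close>
  is annihilated by some \<open>1 - \<gamma> * s\<close>. That factor is a unit, so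
  \<open>\<gamma> ^ j\<close> vanishes.\<close>

lemma power_dvd_power_iff: "\<gamma> ^ i dvd \<gamma> ^ j \<longleftrightarrow> i \<le> j \<or> \<nu> \<le> j"
proof
  assume "\<gamma> ^ i dvd \<gamma> ^ j"
  then obtain r where r: "\<gamma> ^ j = \<gamma> ^ i * r" by blast
  show "i \<le> j \<or> \<nu> \<le> j"
  proof (cases "i \<le> j")
    case False
    then have "i = j + Suc (i - Suc j)" by simp
    then have "\<gamma> ^ i = \<gamma> ^ j * (\<gamma> * \<gamma> ^ (i - Suc j))"
      by (metis power_add power_Suc)
    with r have "\<gamma> ^ j * (1 - \<gamma> * (\<gamma> ^ (i - Suc j) * r)) = 0" by (simp add: algebra_simps)
    moreover obtain u where "1 = (1 - \<gamma> * (\<gamma> ^ (i - Suc j) * r)) * u" using unit_diff by blast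
    ultimately have "\<gamma> ^ j = 0" by (metis mult.assoc mult.right_neutral mult_zero_left)
    then show ?thesis by (simp add: generator_power_eq_0_iff)
  qed simp
next
  show "\<gamma> ^ i dvd \<gamma> ^ j" if "i \<le> j \<or> \<nu> \<le> j"
    using that generator_power_eq_0_iff[of j] by (auto intro: le_imp_power_dvd)
qed

text \<open>Take the greatest \<open>k \<le> \<nu>\<close> for which \<open>\<gamma> ^ k\<close>
  divides \<open>x\<close>. Below \<open>\<nu>\<close>, a nonunit cofactor would be divisible by
  \<open>\<gamma>\<close>, against maximality of \<open>k\<close>.\<close>

lemma power_times_unit:
  obtains k u where "k \<le> \<nu>" "u dvd 1" "x = \<gamma> ^ k * u"
proof -
  define k where "k = (GREATEST k. k \<le> \<nu> \<and> \<gamma> ^ k dvd x)"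
  have "k \<le> \<nu> \<and> \<gamma> ^ k dvd x" unfolding k_def
    by (rule GreatestI_nat[of _ 0 \<nu>]) auto
  then obtain y where y: "k \<le> \<nu>" "x = \<gamma> ^ k * y" by blast
  show ?thesis
  proof (cases "k = \<nu>")
    case True
    \<comment> \<open>Here \<open>x = 0\<close> and the cofactor \<open>y\<close> may fail to be a
      unit, so it is replaced by 1.\<close>
    then have "x = \<gamma> ^ k * 1" using y nilpotent by simp
    then show ?thesis using that[of k 1] y(1) by simp
  next
    case False
    have "\<not> \<gamma> dvd y"
    proof
      assume "\<gamma> dvd y"
      then have "\<gamma> ^ k * \<gamma> dvd \<gamma> ^ k * y" by (rule mult_dvd_mono[OF dvd_refl])
      then have "\<gamma> ^ Suc k dvd x" using y(2) by (simp add: mult.commute)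
      then have "Suc k \<le> \<nu> \<and> \<gamma> ^ Suc k dvd x" using False y(1) by simp
      then have "Suc k \<le> (GREATEST k. k \<le> \<nu> \<and> \<gamma> ^ k dvd x)"
        by (rule Greatest_le_nat[of _ _ \<nu>]) simp
      then have "Suc k \<le> k" by (simp only: k_def)
      then show False by simp
    qed
    then show ?thesis using that[of k y] y unit_or_dvd[of y] by simp
  qed
qed

section \<open>The class of an element under equality of ideals\<close>

definition class_index :: "'a \<Rightarrow> nat" where
  "class_index x = (THE i. i \<le> \<nu> \<and> principal_ideal x = principal_ideal (\<gamma> ^ (\<nu> - i)))"

text \<open>The index is \<open>\<nu>\<close> minus the exponent of \<open>\<gamma>\<close> in
  \<open>x\<close>, so 0 has index 0 and units have index \<open>\<nu>\<close>. It is unique because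
  the powers of \<open>\<gamma>\<close> with exponents up to \<open>\<nu>\<close> generate distinct
  ideals.\<close>

lemma class_index_exists_unique:
  "\<exists>!i. i \<le> \<nu> \<and> principal_ideal x = principal_ideal (\<gamma> ^ (\<nu> - i))"
proof -
  obtain k u where k: "k \<le> \<nu>" "u dvd 1" "x = \<gamma> ^ k * u" by (rule power_times_unit)
  have "\<gamma> ^ k * u dvd \<gamma> ^ k * 1" using k(2) by (rule mult_dvd_mono[OF dvd_refl])
  then have x: "principal_ideal x = principal_ideal (\<gamma> ^ (\<nu> - (\<nu> - k)))"
    using k by (simp add: principal_ideal_eq_iff)
  have "i = j" if "i \<le> \<nu>" "j \<le> \<nu>"
    "principal_ideal (\<gamma> ^ (\<nu> - i)) = principal_ideal (\<gamma> ^ (\<nu> - j))" for i j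
    using that by (auto simp: principal_ideal_eq_iff power_dvd_power_iff)
  then show ?thesis using x by (intro ex1I[of _ "\<nu> - k"]) auto
qed

lemma class_index_le: "class_index x \<le> \<nu>"
  and principal_ideal_class_index:
    "principal_ideal x = principal_ideal (\<gamma> ^ (\<nu> - class_index x))"
  using theI'[OF class_index_exists_unique[of x]] unfolding class_index_def by auto

lemma class_index_eq_iff:
  assumes "i \<le> \<nu>"
  shows "class_index x = i \<longleftrightarrow> principal_ideal x = principal_ideal (\<gamma> ^ (\<nu> - i))"
proof
  show "principal_ideal x = principal_ideal (\<gamma> ^ (\<nu> - i))" if "class_index x = i"
    using principal_ideal_class_index[of x] that by simp
  show "class_index x = i" if "principal_ideal x = principal_ideal (\<gamma> ^ (\<nu> - i))"
    unfolding class_index_def using assms that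
    by (intro the1_equality[OF class_index_exists_unique] conjI)
qed

lemma class_index_decomp:
  obtains u where "u dvd 1" "x = \<gamma> ^ (\<nu> - class_index x) * u"
proof -
  obtain k u where k: "k \<le> \<nu>" "u dvd 1" "x = \<gamma> ^ k * u" by (rule power_times_unit)
  have "\<gamma> ^ k * u dvd \<gamma> ^ k * 1" using k(2) by (rule mult_dvd_mono[OF dvd_refl])
  then have "class_index x = \<nu> - k"
    using k(1,3) by (simp add: class_index_eq_iff principal_ideal_eq_iff)
  then show ?thesis using k that[of u] by simp
qed

text \<open>Generators of the same ideal differ by a unit here, so the unit orbits in the matrix
  entries are the fibres of \<open>class_index\<close>.\<close>

lemma associates_power:
  assumes "j \<le> \<nu>"
  shows "associates (\<gamma> ^ (\<nu> - j)) = {x. class_index x = j}"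
proof (intro set_eqI iffI)
  fix x assume "x \<in> associates (\<gamma> ^ (\<nu> - j))"
  then obtain u where u: "u dvd 1" "x = \<gamma> ^ (\<nu> - j) * u" by (auto simp: associates_def)
  have "\<gamma> ^ (\<nu> - j) * u dvd \<gamma> ^ (\<nu> - j) * 1" using u(1) by (rule mult_dvd_mono[OF dvd_refl])
  then show "x \<in> {x. class_index x = j}" using u assms
    by (simp add: class_index_eq_iff principal_ideal_eq_iff)
next
  fix x assume "x \<in> {x. class_index x = j}"
  then show "x \<in> associates (\<gamma> ^ (\<nu> - j))"
    using class_index_decomp[of x] by (auto simp: associates_def)
qed

text \<open>In the larger ideal write an element as \<open>\<gamma> ^ (\<nu> - Suc j) * u\<close>.
  If it avoids the next smaller ideal, \<open>\<gamma>\<close> does not divide \<open>u\<close>, so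
  \<open>u\<close> is a unit; conversely an associate of \<open>\<gamma> ^ (\<nu> - Suc j)\<close>
  is not divisible by a higher power.\<close>

lemma associates_power_Suc:
  assumes "j < \<nu>"
  shows "associates (\<gamma> ^ (\<nu> - Suc j))
    = principal_ideal (\<gamma> ^ (\<nu> - Suc j)) - principal_ideal (\<gamma> ^ (\<nu> - j))"
proof (intro set_eqI iffI)
  fix x assume "x \<in> associates (\<gamma> ^ (\<nu> - Suc j))"
  then have x: "x dvd \<gamma> ^ (\<nu> - Suc j)" "\<gamma> ^ (\<nu> - Suc j) dvd x"
    using assms by (simp_all add: associates_power class_index_eq_iff principal_ideal_eq_iff)
  have "\<not> \<gamma> ^ (\<nu> - j) dvd \<gamma> ^ (\<nu> - Suc j)"
    using assms unfolding power_dvd_power_iff by linarith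
  then have "\<not> \<gamma> ^ (\<nu> - j) dvd x" using dvd_trans[OF _ x(1)] by metis
  then show "x \<in> principal_ideal (\<gamma> ^ (\<nu> - Suc j)) - principal_ideal (\<gamma> ^ (\<nu> - j))"
    using x(2) by (simp add: principal_ideal_dvd)
next
  fix x assume "x \<in> principal_ideal (\<gamma> ^ (\<nu> - Suc j)) - principal_ideal (\<gamma> ^ (\<nu> - j))"
  then obtain u where u: "x = \<gamma> ^ (\<nu> - Suc j) * u" and nd: "\<not> \<gamma> ^ (\<nu> - j) dvd x"
    by (auto simp: principal_ideal_dvd)
  have "\<nu> - j = Suc (\<nu> - Suc j)" using assms by simp
  then have "\<gamma> ^ (\<nu> - j) = \<gamma> ^ (\<nu> - Suc j) * \<gamma>" by (simp add: mult.commute)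
  then have "\<not> \<gamma> dvd u" using u nd mult_dvd_mono[OF dvd_refl] by metis
  then show "x \<in> associates (\<gamma> ^ (\<nu> - Suc j))"
    using u unit_or_dvd[of u] by (auto simp: associates_def)
qed

section \<open>Annihilators and sizes of the ideals\<close>

lemma power_mult_eq_0_iff:
  assumes "k \<le> \<nu>"
  shows "\<gamma> ^ k * x = 0 \<longleftrightarrow> \<gamma> ^ (\<nu> - k) dvd x"
proof
  assume "\<gamma> ^ (\<nu> - k) dvd x"
  then have "\<gamma> ^ k * \<gamma> ^ (\<nu> - k) dvd \<gamma> ^ k * x" by (rule mult_dvd_mono[OF dvd_refl])
  then show "\<gamma> ^ k * x = 0" using assms nilpotent by (simp flip: power_add)
next
  assume 0: "\<gamma> ^ k * x = 0"
  obtain l u where l: "u dvd 1" "x = \<gamma> ^ l * u" by (rule power_times_unit)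
  then obtain v where "1 = u * v" by blast
  \<comment> \<open>Cancelling the unit part of \<open>x\<close> leaves a pure power of
    \<open>\<gamma>\<close>, whose vanishing is decided by its exponent.\<close>
  then have "\<gamma> ^ (k + l) = \<gamma> ^ k * x * v"
    using l by (simp add: power_add mult.assoc)
  then have "\<nu> - k \<le> l" using 0 generator_power_eq_0_iff[of "k + l"] by simp
  then show "\<gamma> ^ (\<nu> - k) dvd x" using l by (simp add: le_imp_power_dvd dvd_mult2)
qed

text \<open>Multiplication by \<open>\<gamma> ^ (\<nu> - 1)\<close> has kernel
  \<open>principal_ideal \<gamma>\<close>, so the residue classes correspond to the elements of its
  image.\<close>

lemma card_quotient_ring:
  assumes "\<nu> > 0"
  shows "card (quotient_ring (principal_ideal \<gamma>)) = card (principal_ideal (\<gamma> ^ (\<nu> - 1)))"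
proof -
  have "\<gamma> dvd a - b \<longleftrightarrow> \<gamma> ^ (\<nu> - 1) * a = \<gamma> ^ (\<nu> - 1) * b" for a b
    using power_mult_eq_0_iff[of "\<nu> - 1" "a - b"] assms by (simp add: right_diff_distrib)
  then have "quotient_ring (principal_ideal \<gamma>)
      = UNIV // {(a, b). \<gamma> ^ (\<nu> - 1) * a = \<gamma> ^ (\<nu> - 1) * b}"
    by (simp add: quotient_ring_def principal_ideal_dvd)
  then show ?thesis by (simp add: card_quotient_kernel principal_ideal_def)
qed

text \<open>Multiplication by \<open>\<gamma>\<close> maps each ideal of the chain onto the next
  smaller one. Its kernel is the smallest nonzero ideal, which has as many elements as the residue
  ring, so each step up the chain contributes one such factor.\<close>

lemma card_principal_ideal_power:
  assumes "\<nu> > 0" "j \<le> \<nu>"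
  shows "card (principal_ideal (\<gamma> ^ (\<nu> - j))) = card (quotient_ring (principal_ideal \<gamma>)) ^ j"
  using assms(2)
proof (induction j)
  case 0
  then show ?case using nilpotent by (simp add: principal_ideal_def)
next
  case (Suc j)
  let ?I = "principal_ideal (\<gamma> ^ (\<nu> - Suc j))"
  have e: "\<nu> - j = Suc (\<nu> - Suc j)" using Suc.prems by simp
  have "(*) \<gamma> ` ?I = principal_ideal (\<gamma> ^ (\<nu> - j))"
    unfolding e principal_ideal_def image_image by (simp add: mult.assoc)
  moreover have "{x \<in> ?I. \<gamma> * x = 0} = principal_ideal (\<gamma> ^ (\<nu> - 1))"
  proof -
    \<comment> \<open>The whole annihilator of \<open>\<gamma>\<close> lies in \<open>?I\<close>, so
      restricting to \<open>?I\<close> does not shrink the kernel.\<close>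
    have "\<gamma> ^ (\<nu> - Suc j) dvd \<gamma> ^ (\<nu> - 1)" by (rule le_imp_power_dvd) simp
    then show ?thesis using power_mult_eq_0_iff[of 1] assms(1)
      by (auto simp: principal_ideal_dvd dest: dvd_trans)
  qed
  moreover have "card ?I = card ((*) \<gamma> ` ?I) * card {x \<in> ?I. \<gamma> * x = 0}"
    by (rule card_eq_card_image_times_card_kernel)
      (auto simp: principal_ideal_dvd algebra_simps)
  ultimately show ?case using Suc card_quotient_ring[OF assms(1)] by simp
qed

section \<open>Character sums over ideals and the matrix entries\<close>

lemma sum_character_principal_ideal:
  assumes "generating_character \<psi>" "\<nu> > 0" "i \<le> \<nu>" "j \<le> \<nu>"
  shows "(\<Sum>r\<in>principal_ideal (\<gamma> ^ (\<nu> - j)). \<psi> (r * \<gamma> ^ (\<nu> - i)))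
    = (if j \<le> \<nu> - i then of_nat (card (quotient_ring (principal_ideal \<gamma>))) ^ j else 0)"
proof -
  let ?I = "principal_ideal (\<gamma> ^ (\<nu> - j))"
  have \<psi>: "additive_character \<psi>" using assms(1) by (simp add: generating_character_def)
  show ?thesis
  proof (cases "j \<le> \<nu> - i")
    case True
    then have "\<nu> \<le> \<nu> - j + (\<nu> - i)" using assms by simp
    then have "\<gamma> ^ (\<nu> - j) * \<gamma> ^ (\<nu> - i) = 0" by (simp add: generator_power_eq_0_iff flip: power_add)
    then have "r * \<gamma> ^ (\<nu> - i) = 0" if "r \<in> ?I" for r
      using that by (auto simp: principal_ideal_def mult.commute mult.left_commute)
    then have "(\<Sum>r\<in>?I. \<psi> (r * \<gamma> ^ (\<nu> - i))) = (\<Sum>r\<in>?I. 1)"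
      using additive_character_0[OF \<psi>] by (intro sum.cong) auto
    then show ?thesis using True card_principal_ideal_power assms by simp
  next
    case False
    then have "\<gamma> ^ (\<nu> - j) * \<gamma> ^ (\<nu> - i) \<noteq> 0" using assms(3,4)
      by (simp add: generator_power_eq_0_iff flip: power_add)
    \<comment> \<open>The product of the two powers is nonzero since \<open>i + j > \<nu>\<close>,
      so \<open>\<psi>\<close> is nontrivial on its multiples, and
      \<open>\<gamma> ^ (\<nu> - j) * r\<close> is the element of \<open>?I\<close> by which to
      translate.\<close>
    then obtain r where "\<psi> (r * (\<gamma> ^ (\<nu> - j) * \<gamma> ^ (\<nu> - i))) \<noteq> 1"
      using generating_character_nontrivial assms(1) by metis
    then have "\<psi> ((\<gamma> ^ (\<nu> - j) * r) * \<gamma> ^ (\<nu> - i)) \<noteq> 1" by (simp add: mult.commute mult.left_commute)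
    moreover have "\<gamma> ^ (\<nu> - j) * r \<in> ?I" by (simp add: principal_ideal_dvd)
    ultimately show ?thesis using False
      by (subst sum_additive_character_eq_0[OF \<psi>, where f = "\<lambda>r. r * \<gamma> ^ (\<nu> - i)"])
        (auto simp: principal_ideal_dvd distrib_right)
  qed
qed

lemma character_matrix_eq:
  assumes "generating_character \<psi>" "\<nu> > 0" "i \<le> \<nu>" "j \<le> \<nu>"
    and q: "q = card (quotient_ring (principal_ideal \<gamma>))"
  shows "character_matrix \<psi> \<gamma> \<nu> i j =
     (if j = 0 then 1
      else if 1 \<le> j \<and> j \<le> \<nu> - i then of_nat q ^ j - of_nat q ^ (j - 1)
      else if j = \<nu> + 1 - i then - (of_nat q ^ (\<nu> - i))
      else 0)"
proof (cases j)
  case 0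
  have "associates (\<gamma> ^ \<nu>) = {0}" using nilpotent
    by (auto simp: associates_def intro!: image_eqI[of _ _ 1])
  then show ?thesis using 0 assms(1) additive_character_0[of \<psi>]
    by (simp add: character_matrix_def generating_character_def)
next
  case (Suc k)
  then have k: "k < \<nu>" using assms by simp
  have "principal_ideal (\<gamma> ^ (\<nu> - k)) \<subseteq> principal_ideal (\<gamma> ^ (\<nu> - Suc k))"
    using power_dvd_power_iff[of "\<nu> - Suc k" "\<nu> - k"] unfolding principal_ideal_dvd
    by (meson Collect_mono diff_le_mono2 dvd_trans le_SucI order_refl)
  then have "character_matrix \<psi> \<gamma> \<nu> i j
     = (\<Sum>r\<in>principal_ideal (\<gamma> ^ (\<nu> - Suc k)). \<psi> (r * \<gamma> ^ (\<nu> - i)))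
     - (\<Sum>r\<in>principal_ideal (\<gamma> ^ (\<nu> - k)). \<psi> (r * \<gamma> ^ (\<nu> - i)))"
    unfolding character_matrix_def Suc associates_power_Suc[OF k] by (intro sum_diff) auto
  also have "\<dots> = (if Suc k \<le> \<nu> - i then of_nat q ^ Suc k else 0) - (if k \<le> \<nu> - i then of_nat q ^ k else 0)"
    using k assms by (simp add: sum_character_principal_ideal)
  \<comment> \<open>At \<open>k = \<nu> - i\<close> the larger ideal sums to 0 while the smaller one
    still contributes its size; this is the single negative entry, at
    \<open>j = \<nu> + 1 - i\<close>.\<close>
  finally show ?thesis using Suc assms by (cases "k = \<nu> - i") auto
qed

end

section \<open>Substitution into polynomials\<close>

lemma const_poly_0: "const_poly 0 = 0"
  by (simp add: const_poly_def)

lemma const_poly_1: "const_poly 1 = 1"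
  by (simp add: const_poly_def)

lemma const_poly_add: "const_poly (a + b) = const_poly a + const_poly b"
  by (simp add: const_poly_def single_add)

lemma const_poly_mult: "const_poly (a * b) = const_poly a * const_poly b"
  by (simp add: const_poly_def mult_single)

lemma const_poly_sum: "const_poly (\<Sum>x\<in>A. f x) = (\<Sum>x\<in>A. const_poly (f x))"
  by (induction A rule: infinite_finite_induct) (auto simp: const_poly_0 const_poly_add)

lemma const_poly_prod: "const_poly (\<Prod>x\<in>A. f x) = (\<Prod>x\<in>A. const_poly (f x))"
  by (induction A rule: infinite_finite_induct) (auto simp: const_poly_1 const_poly_mult)

text \<open>Monomials outside the support have coefficient 0. A common index set for several
  polynomials is what makes additivity of \<open>substitute\<close> visible, as cancellation can
  shrink the support of a sum.\<close>

lemma substitute_superset: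
  assumes "finite K" "Poly_Mapping.keys p \<subseteq> K"
  shows "substitute \<sigma> p = (\<Sum>m\<in>K. const_poly (Poly_Mapping.lookup p m) *
    (\<Prod>i\<in>Poly_Mapping.keys m. \<sigma> i ^ Poly_Mapping.lookup m i))"
  unfolding substitute_def using assms
  by (intro sum.mono_neutral_left) (auto simp: in_keys_iff const_poly_0)

lemma substitute_0: "substitute \<sigma> 0 = 0"
  by (simp add: substitute_def)

lemma substitute_add: "substitute \<sigma> (p + q) = substitute \<sigma> p + substitute \<sigma> q"
proof -
  let ?K = "Poly_Mapping.keys p \<union> Poly_Mapping.keys q"
  have "Poly_Mapping.keys (p + q) \<subseteq> ?K" by (rule Poly_Mapping.keys_add)
  then show ?thesis
    by (simp add: substitute_superset[of ?K] lookup_add const_poly_add distrib_right sum.distrib)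
qed

lemma substitute_sum: "substitute \<sigma> (\<Sum>x\<in>A. f x) = (\<Sum>x\<in>A. substitute \<sigma> (f x))"
  by (induction A rule: infinite_finite_induct) (auto simp: substitute_0 substitute_add)

lemma indet_power: "indet i ^ n = Poly_Mapping.single (Poly_Mapping.single i n) 1"
proof (induction n)
  case (Suc n)
  have "Poly_Mapping.single i 1 + Poly_Mapping.single i n = Poly_Mapping.single i (Suc n)"
    using single_add[of i 1 n] by simp
  then show ?case using Suc by (simp add: indet_def mult_single)
qed simp

lemma prod_indet_power:
  "(\<Prod>i\<in>I. indet i ^ e i) = Poly_Mapping.single (\<Sum>i\<in>I. Poly_Mapping.single i (e i)) 1"
  by (induction I rule: infinite_finite_induct) (auto simp: indet_power mult_single)

lemma substitute_monomial:
  assumes "finite I"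
  shows "substitute \<sigma> (\<Prod>i\<in>I. indet i ^ e i) = (\<Prod>i\<in>I. \<sigma> i ^ e i)"
proof -
  let ?m = "\<Sum>i\<in>I. Poly_Mapping.single i (e i)"
  have lookup: "Poly_Mapping.lookup ?m i = (if i \<in> I then e i else 0)" for i
    using assms by (simp add: lookup_sum lookup_single when_def)
  have "substitute \<sigma> (\<Prod>i\<in>I. indet i ^ e i)
      = (\<Prod>i\<in>Poly_Mapping.keys ?m. \<sigma> i ^ Poly_Mapping.lookup ?m i)"
    by (simp add: prod_indet_power substitute_def const_poly_1)
  \<comment> \<open>Indices with \<open>e i = 0\<close> are absent from the keys; their factors are
    1.\<close>
  also have "\<dots> = (\<Prod>i\<in>I. \<sigma> i ^ Poly_Mapping.lookup ?m i)"
    using assms by (intro prod.mono_neutral_left) (auto simp: in_keys_iff lookup split: if_splits)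
  also have "\<dots> = (\<Prod>i\<in>I. \<sigma> i ^ e i)" by (rule prod.cong) (simp_all add: lookup)
  finally show ?thesis .
qed

section \<open>The MacWilliams identity\<close>

text \<open>Expanding the product chooses one \<open>r\<close> for each coordinate, and such a
  choice is a vector.\<close>

lemma prod_sum_vec:
  fixes g :: "'n::finite \<Rightarrow> 'a::finite \<Rightarrow> 'b::comm_semiring_1"
  shows "(\<Prod>l\<in>UNIV. \<Sum>r\<in>UNIV. g l r) = (\<Sum>v\<in>(UNIV :: ('a ^ 'n) set). \<Prod>l\<in>UNIV. g l (v $ l))"
proof -
  have "(\<Prod>l\<in>UNIV. \<Sum>r\<in>UNIV. g l r) = (\<Sum>f\<in>UNIV. \<Prod>l\<in>UNIV. g l (f l))"
    by (simp add: prod_sum_PiE PiE_UNIV_domain)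
  also have "\<dots> = (\<Sum>v\<in>(UNIV :: ('a ^ 'n) set). \<Prod>l\<in>UNIV. g l (v $ l))"
    by (rule sum.reindex_bij_witness[where i = "\<lambda>v. ($) v" and j = vec_lambda]) auto
  finally show ?thesis .
qed

lemma additive_character_sum:
  assumes "additive_character \<psi>"
  shows "\<psi> (\<Sum>x\<in>A. f x) = (\<Prod>x\<in>A. \<psi> (f x))"
  using additive_character_0[OF assms] assms
  by (induction A rule: infinite_finite_induct) (auto simp: additive_character_def)

text \<open>If some codeword has nonzero inner product with \<open>v\<close>, a scalar multiple of
  it, again in \<open>C\<close>, has an inner product on which \<open>\<psi>\<close> is not 1, and
  orthogonality applies.\<close>

lemma sum_character_code:
  fixes C :: "('a::{finite, comm_ring_1} ^ 'n) set"
  assumes "generating_character \<psi>" "linear_code C"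
  shows "(\<Sum>c\<in>C. \<psi> (\<Sum>l\<in>UNIV. c $ l * v $ l)) = (if v \<in> dual_code C then of_nat (card C) else 0)"
proof -
  let ?dot = "\<lambda>c. \<Sum>l\<in>UNIV. c $ l * v $ l"
  have \<psi>: "additive_character \<psi>" using assms(1) by (simp add: generating_character_def)
  show ?thesis
  proof (cases "v \<in> dual_code C")
    case True
    then have "(\<Sum>c\<in>C. \<psi> (?dot c)) = (\<Sum>c\<in>C. 1)"
      using additive_character_0[OF \<psi>] by (intro sum.cong) (auto simp: dual_code_def)
    then show ?thesis using True by simp
  next
    case False
    then obtain c where c: "c \<in> C" "?dot c \<noteq> 0" by (auto simp: dual_code_def)
    obtain r where "\<psi> (r * ?dot c) \<noteq> 1"
      using generating_character_nontrivial[OF assms(1) c(2)] .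
    then have "\<psi> (?dot (r *s c)) \<noteq> 1" by (simp add: sum_distrib_left mult.assoc)
    moreover have "r *s c \<in> C" using assms(2) c(1) by (simp add: linear_code_iff)
    ultimately have "(\<Sum>c\<in>C. \<psi> (?dot c)) = 0"
      using assms(2)
      by (intro sum_additive_character_eq_0[OF \<psi>, where f = ?dot])
        (auto simp: linear_code_iff distrib_right sum.distrib)
    then show ?thesis using False by simp
  qed
qed

context finite_chain_ring
begin

section \<open>Enumerators as products over coordinates\<close>

lemma class_support_eq:
  "i \<le> \<nu> \<Longrightarrow> class_support \<gamma> \<nu> i c = {l. class_index (c $ l) = i}"
  by (simp add: class_support_def class_index_eq_iff)

text \<open>Coordinates are grouped by class. The function \<open>h\<close> is arbitrary, so the
  identity serves the enumerator before and after substitution.\<close>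

lemma prod_class_support:
  fixes h :: "nat \<Rightarrow> 'b::comm_semiring_1" and c :: "'a ^ 'n"
  shows "(\<Prod>i\<le>\<nu>. h i ^ card (class_support \<gamma> \<nu> i c)) = (\<Prod>l\<in>UNIV. h (class_index (c $ l)))"
proof -
  have "(\<Prod>l\<in>UNIV. h (class_index (c $ l)))
      = (\<Prod>i\<le>\<nu>. \<Prod>l\<in>{l. l \<in> UNIV \<and> class_index (c $ l) = i}. h (class_index (c $ l)))"
    by (rule prod.group[symmetric]) (auto simp: class_index_le)
  also have "\<dots> = (\<Prod>i\<le>\<nu>. h i ^ card (class_support \<gamma> \<nu> i c))"
    by (rule prod.cong) (simp_all add: class_support_eq)
  finally show ?thesis ..
qed

lemma class_index_unit_mult:
  assumes "u dvd 1"
  shows "class_index (u * r) = class_index r"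
proof -
  have "u * r dvd 1 * r" using assms by (rule mult_dvd_mono) simp
  then have "principal_ideal (u * r) = principal_ideal r" by (simp add: principal_ideal_eq_iff)
  then show ?thesis by (simp add: class_index_def)
qed

text \<open>The entry is defined through the representative \<open>\<gamma> ^ (\<nu> - i)\<close>.
  Passing to any \<open>x\<close> of that class introduces a unit, which is absorbed because
  multiplication by a unit permutes each class.\<close>

lemma character_matrix_class_index:
  assumes "j \<le> \<nu>"
  shows "character_matrix \<psi> \<gamma> \<nu> (class_index x) j = (\<Sum>r | class_index r = j. \<psi> (r * x))"
proof -
  obtain u where u: "u dvd 1" "x = \<gamma> ^ (\<nu> - class_index x) * u" by (rule class_index_decomp)
  then obtain v where v: "u * v = 1" by (metis dvdE)
  then have "v dvd 1" by (metis dvd_triv_right)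
  have "(\<Sum>r | class_index r = j. \<psi> (r * \<gamma> ^ (\<nu> - class_index x)))
      = (\<Sum>r | class_index r = j. \<psi> (r * x))"
  proof (rule sum.reindex_bij_witness[where i = "\<lambda>r. u * r" and j = "\<lambda>r. v * r"])
    fix r
    have "u * (v * r) = u * v * r" "v * (u * r) = u * v * r" by (simp_all only: ac_simps)
    then show "u * (v * r) = r" "v * (u * r) = r" using v by simp_all
    have "v * r * x = u * v * (r * \<gamma> ^ (\<nu> - class_index x))"
      by (subst u(2)) (simp only: ac_simps)
    then show "\<psi> (v * r * x) = \<psi> (r * \<gamma> ^ (\<nu> - class_index x))" using v by simp
  qed (use class_index_unit_mult u(1) \<open>v dvd 1\<close> in auto)
  then show ?thesis using assms by (simp add: character_matrix_def associates_power)
qed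

text \<open>The right-hand side is the Fourier transform at \<open>x\<close> of
  \<open>r \<mapsto> indet (class_index r)\<close>; grouping \<open>r\<close> by class turns it into
  an entry of the matrix applied to the indeterminates.\<close>

lemma sum_character_matrix_indet:
  "(\<Sum>j\<le>\<nu>. const_poly (character_matrix \<psi> \<gamma> \<nu> (class_index x) j) * indet j)
    = (\<Sum>r\<in>UNIV. const_poly (\<psi> (r * x)) * indet (class_index r))"
proof -
  have "(\<Sum>r\<in>UNIV. const_poly (\<psi> (r * x)) * indet (class_index r))
      = (\<Sum>j\<le>\<nu>. \<Sum>r\<in>{r. r \<in> UNIV \<and> class_index r = j}. const_poly (\<psi> (r * x)) * indet (class_index r))"
    by (rule sum.group[symmetric]) (auto simp: class_index_le)
  also have "\<dots> = (\<Sum>j\<le>\<nu>. const_poly (character_matrix \<psi> \<gamma> \<nu> (class_index x) j) * indet j)"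
    by (rule sum.cong)
      (simp_all add: character_matrix_class_index const_poly_sum sum_distrib_right)
  finally show ?thesis ..
qed

text \<open>Poisson summation on \<open>C\<close> for the product function \<open>v \<mapsto> \<Prod>l. indet (class_index (v $ l))\<close>.\<close>

lemma substitute_swe:
  fixes C :: "('a ^ 'n) set"
  assumes "generating_character \<psi>" "linear_code C"
  shows "substitute (\<lambda>i. \<Sum>j\<le>\<nu>. const_poly (character_matrix \<psi> \<gamma> \<nu> i j) * indet j) (swe \<gamma> \<nu> C)
    = const_poly (of_nat (card C)) * swe \<gamma> \<nu> (dual_code C)"
    (is "?L = _")
proof -
  let ?F = "\<lambda>v :: 'a ^ 'n. \<Prod>l\<in>UNIV. indet (class_index (v $ l))"
  let ?dot = "\<lambda>c v :: 'a ^ 'n. \<Sum>l\<in>UNIV. c $ l * v $ l"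
  have \<psi>: "additive_character \<psi>" using assms(1) by (simp add: generating_character_def)
  have "?L = (\<Sum>c\<in>C. \<Prod>l\<in>UNIV. \<Sum>r\<in>UNIV. const_poly (\<psi> (r * c $ l)) * indet (class_index r))"
    unfolding swe_def substitute_sum substitute_monomial[OF finite_atMost]
    by (simp only: prod_class_support sum_character_matrix_indet)
  \<comment> \<open>After expansion over all vectors \<open>v\<close>, additivity merges the
    coordinate characters into one value at the inner product of \<open>c\<close> and
    \<open>v\<close>.\<close>
  also have "\<dots> = (\<Sum>c\<in>C. \<Sum>v\<in>UNIV. const_poly (\<psi> (?dot c v)) * ?F v)"
    by (simp add: prod_sum_vec prod.distrib additive_character_sum[OF \<psi>] const_poly_prod mult.commute)
  \<comment> \<open>With the sums exchanged, the coefficient of \<open>?F v\<close> is a character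
    sum over the code, which selects the dual code.\<close>
  also have "\<dots> = (\<Sum>v\<in>UNIV. const_poly (\<Sum>c\<in>C. \<psi> (?dot c v)) * ?F v)"
    by (subst sum.swap) (simp add: const_poly_sum sum_distrib_right)
  also have "\<dots> = (\<Sum>v\<in>UNIV. if v \<in> dual_code C then const_poly (of_nat (card C)) * ?F v else 0)"
    by (rule sum.cong) (simp_all add: sum_character_code[OF assms] const_poly_0)
  also have "\<dots> = const_poly (of_nat (card C)) * swe \<gamma> \<nu> (dual_code C)"
    by (simp add: swe_def prod_class_support sum_distrib_left sum.If_cases)
  finally show ?thesis .
qed

end

theorem corollary12:
  fixes \<psi> :: "'a::{finite, comm_ring_1} \<Rightarrow> complex"
    and \<gamma> :: 'a
    and \<nu> q :: nat
    and C :: "('a ^ 'n) set"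
  assumes "chain_ring TYPE('a)"
    and "maximal_ideal (principal_ideal \<gamma>)"
    and "\<nu> > 0" and "\<gamma> ^ \<nu> = 0" and "\<And>k. k > 0 \<Longrightarrow> \<gamma> ^ k = 0 \<Longrightarrow> \<nu> \<le> k"
    and "q = card (quotient_ring (principal_ideal \<gamma>))"
    and "generating_character \<psi>"
    and "linear_code C"
  shows "swe \<gamma> \<nu> (dual_code C) =
           const_poly (1 / of_nat (card C)) *
           substitute (\<lambda>i. \<Sum>j\<le>\<nu>. const_poly (character_matrix \<psi> \<gamma> \<nu> i j) * indet j) (swe \<gamma> \<nu> C)
       \<and> (\<forall>i\<le>\<nu>. \<forall>j\<le>\<nu>.
           character_matrix \<psi> \<gamma> \<nu> i j =
             (if j = 0 then 1
              else if 1 \<le> j \<and> j \<le> \<nu> - i then of_nat q ^ j - of_nat q ^ (j - 1)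
              else if j = \<nu> + 1 - i then - (of_nat q ^ (\<nu> - i))
              else 0))"
proof -
  interpret finite_chain_ring \<gamma> \<nu>
    using assms(1,2,4,5) by unfold_locales
  let ?S = "\<lambda>i. \<Sum>j\<le>\<nu>. const_poly (character_matrix \<psi> \<gamma> \<nu> i j) * indet j"
  \<comment> \<open>The zero word lies in \<open>C\<close>, so dividing by the size of the code is
    legitimate.\<close>
  have "card C \<noteq> 0" using assms(8) by (auto simp: linear_code_iff)
  then have "const_poly (1 / of_nat (card C)) * const_poly (of_nat (card C)) = 1"
    by (simp add: const_poly_1 flip: const_poly_mult)
  then have "swe \<gamma> \<nu> (dual_code C)
      = const_poly (1 / of_nat (card C)) * (const_poly (of_nat (card C)) * swe \<gamma> \<nu> (dual_code C))"
    by (simp flip: mult.assoc)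
  then have "swe \<gamma> \<nu> (dual_code C)
      = const_poly (1 / of_nat (card C)) * substitute ?S (swe \<gamma> \<nu> C)"
    by (simp only: substitute_swe[OF assms(7,8)])
  then show ?thesis using character_matrix_eq[OF assms(7,3) _ _ assms(6)] by blast
qed

end
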